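(* Let $R$ be an Artinian (or, in particular, a finite) ring. Then the following three statements are equivalent: (1) $R$ is a $UJ^{\#}$ ring. (2) $R$ is a $UJ$ ring. (3) $R$ is a $UU$ ring.
   Context: All rings are associative with identity. $J(R)$ is the Jacobson radical, $U(R)$ the group of units and $Nil(R)$ the set of nilpotent elements of $R$. Define $J^{\#}(R)=\{z\in R : z^n\in J(R)\text{ for some } n\ge 1\}$. A ring $R$ is called a $UJ^{\#}$ ring if $U(R)=1+J^{\#}(R)$, a $UJ$ ring if $U(R)=1+J(R)$, and a $UU$ ring if $U(R)=1+Nil(R)$. *)

theory Defs
  imports "HOL-Algebra.Algebra"
begin

text \<open>
  The locale \<open>ring\<close> covers noncommutative unital rings, the zero ring included, but the locale
  \<open>ideal\<close> is two-sided, so one-sided ideals are introduced here.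
\<close>

definition left_ideal :: "'a set \<Rightarrow> ('a, 'b) ring_scheme \<Rightarrow> bool"
  where "left_ideal I R \<longleftrightarrow>
    additive_subgroup I R \<and> (\<forall>r\<in>carrier R. \<forall>x\<in>I. r \<otimes>\<^bsub>R\<^esub> x \<in> I)"

definition right_ideal :: "'a set \<Rightarrow> ('a, 'b) ring_scheme \<Rightarrow> bool"
  where "right_ideal I R \<longleftrightarrow>
    additive_subgroup I R \<and> (\<forall>r\<in>carrier R. \<forall>x\<in>I. x \<otimes>\<^bsub>R\<^esub> r \<in> I)"

definition maximal_left_ideal :: "'a set \<Rightarrow> ('a, 'b) ring_scheme \<Rightarrow> bool"
  where "maximal_left_ideal I R \<longleftrightarrow>
    left_ideal I R \<and> I \<noteq> carrier R \<and>
    (\<forall>K. left_ideal K R \<and> I \<subseteq> K \<longrightarrow> K = I \<or> K = carrier R)"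

definition left_artinian :: "('a, 'b) ring_scheme \<Rightarrow> bool"
  where "left_artinian R \<longleftrightarrow>
    (\<forall>I :: nat \<Rightarrow> 'a set.
      (\<forall>n. left_ideal (I n) R \<and> I (Suc n) \<subseteq> I n) \<longrightarrow> (\<exists>N. \<forall>n\<ge>N. I n = I N))"

definition right_artinian :: "('a, 'b) ring_scheme \<Rightarrow> bool"
  where "right_artinian R \<longleftrightarrow>
    (\<forall>I :: nat \<Rightarrow> 'a set.
      (\<forall>n. right_ideal (I n) R \<and> I (Suc n) \<subseteq> I n) \<longrightarrow> (\<exists>N. \<forall>n\<ge>N. I n = I N))"

text \<open>
  Intersecting with the carrier only matters for the zero ring, which has no maximal left ideal;
  its Jacobson radical is the whole ring.
\<close>

definition jacobson_radical :: "('a, 'b) ring_scheme \<Rightarrow> 'a set"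
  where "jacobson_radical R = carrier R \<inter> \<Inter>{I. maximal_left_ideal I R}"

definition nilpotents :: "('a, 'b) ring_scheme \<Rightarrow> 'a set"
  where "nilpotents R = {z \<in> carrier R. \<exists>n::nat. n \<ge> 1 \<and> z [^]\<^bsub>R\<^esub> n = \<zero>\<^bsub>R\<^esub>}"

definition jacobson_sharp :: "('a, 'b) ring_scheme \<Rightarrow> 'a set"
  where "jacobson_sharp R =
    {z \<in> carrier R. \<exists>n::nat. n \<ge> 1 \<and> z [^]\<^bsub>R\<^esub> n \<in> jacobson_radical R}"

definition UJ_sharp_ring :: "('a, 'b) ring_scheme \<Rightarrow> bool"
  where "UJ_sharp_ring R \<longleftrightarrow> Units R = \<one>\<^bsub>R\<^esub> <+\<^bsub>R\<^esub> jacobson_sharp R"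

definition UJ_ring :: "('a, 'b) ring_scheme \<Rightarrow> bool"
  where "UJ_ring R \<longleftrightarrow> Units R = \<one>\<^bsub>R\<^esub> <+\<^bsub>R\<^esub> jacobson_radical R"

definition UU_ring :: "('a, 'b) ring_scheme \<Rightarrow> bool"
  where "UU_ring R \<longleftrightarrow> Units R = \<one>\<^bsub>R\<^esub> <+\<^bsub>R\<^esub> nilpotents R"

end

theory Submission
  imports Defs
begin

text \<open>
  In an Artinian ring every non-nilpotent element has a left multiple that is a nonzero idempotent.
  Hence the radical is nil, \<open>J\<^sup># = Nil\<close>, and all that remains is that the nilpotents of a UU ring
  lie in \<open>J\<close>. If \<open>a\<^sup>2 = 0\<close> but \<open>a \<notin> J\<close>, an idempotent \<open>e = w a \<noteq> 0\<close> produces a system of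
  2 by 2 matrix units, and the product of two elementary matrices is a unit \<open>1 + n\<close> with \<open>n\<close> not
  nilpotent. So square-zero elements lie in \<open>J\<close>, which makes idempotents central modulo \<open>J\<close>.
  If now \<open>a\<close> is nilpotent and \<open>e = w a\<close> is idempotent, then \<open>e\<close> is congruent to \<open>w\<^sup>k a\<^sup>k\<close> modulo
  \<open>J\<close> for all \<open>k\<close>, so \<open>e \<in> J\<close> and \<open>e = 0\<close>.
\<close>

text \<open>All later arguments use the chain conditions only through this property, so the left
  Artinian, right Artinian and finite cases share everything that follows from it.\<close>

definition nil_semipotent :: "('a, 'b) ring_scheme \<Rightarrow> bool"
  where "nil_semipotent R \<longleftrightarrow>
    (\<forall>t\<in>carrier R - nilpotents R. \<exists>z\<in>carrier R.
      z \<otimes>\<^bsub>R\<^esub> t \<noteq> \<zero>\<^bsub>R\<^esub> \<and> (z \<otimes>\<^bsub>R\<^esub> t) \<otimes>\<^bsub>R\<^esub> (z \<otimes>\<^bsub>R\<^esub> t) = z \<otimes>\<^bsub>R\<^esub> t)"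

context ring
begin

subsection \<open>Nilpotent elements\<close>

lemma nilpotentsI:
  assumes "z \<in> carrier R" "z [^] (n::nat) = \<zero>"
  shows "z \<in> nilpotents R"
proof -
  have "z [^] Suc n = \<zero>" using assms by simp
  then show ?thesis using assms(1) unfolding nilpotents_def by (auto intro!: exI[of _ "Suc n"])
qed

lemma nilpotents_closed: "z \<in> nilpotents R \<Longrightarrow> z \<in> carrier R"
  by (simp add: nilpotents_def)

lemma nilpotentsE:
  assumes "z \<in> nilpotents R"
  obtains n :: nat where "z \<in> carrier R" "z [^] n = \<zero>"
  using assms unfolding nilpotents_def by auto

lemma pow_mult_swap:
  assumes "x \<in> carrier R" "y \<in> carrier R"
  shows "(y \<otimes> x) [^] Suc n = y \<otimes> (x \<otimes> y) [^] n \<otimes> x"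
proof (induction n)
  case (Suc n)
  have "(y \<otimes> x) [^] Suc (Suc n) = (y \<otimes> (x \<otimes> y) [^] n \<otimes> x) \<otimes> (y \<otimes> x)"
    using Suc by simp
  also have "\<dots> = y \<otimes> (x \<otimes> y) [^] Suc n \<otimes> x" using assms by (simp add: m_assoc)
  finally show ?case .
qed (use assms in simp)

text \<open>Needed to turn nilpotency of \<open>r x a\<close> into nilpotency of
  \<open>x a r\<close> when the radical is shown to be closed under right multiplication.\<close>

lemma nilpotent_mult_swap:
  assumes "x \<in> carrier R" "y \<in> carrier R" "x \<otimes> y \<in> nilpotents R"
  shows "y \<otimes> x \<in> nilpotents R"
proof -
  obtain n :: nat where "(x \<otimes> y) [^] n = \<zero>" using assms(3) by (rule nilpotentsE)
  then have "(y \<otimes> x) [^] Suc n = \<zero>" using assms pow_mult_swap[of x y n] by simp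
  then show ?thesis using assms by (intro nilpotentsI[of _ "Suc n"]) auto
qed

lemma nilpotent_uminus:
  assumes "z \<in> nilpotents R"
  shows "\<ominus> z \<in> nilpotents R"
proof -
  obtain n :: nat where z: "z \<in> carrier R" "z [^] n = \<zero>" using assms by (rule nilpotentsE)
  \<comment> \<open>Leaving the sign open avoids tracking the parity of \<open>k\<close>.\<close>
  have "(\<ominus> z) [^] k = z [^] k \<or> (\<ominus> z) [^] k = \<ominus> (z [^] k)" for k :: nat
    by (induction k) (use z in \<open>auto simp: r_minus l_minus\<close>)
  from this[of n] show ?thesis using z by (intro nilpotentsI[of _ n]) auto
qed

text \<open>The inverse is the finite geometric series \<open>1 + z + ... + z^(n-1)\<close>, where
  \<open>z^n = 0\<close>.\<close>

lemma one_minus_nilpotent_Units: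
  assumes "z \<in> nilpotents R"
  shows "\<one> \<ominus> z \<in> Units R"
proof -
  obtain n :: nat where z: "z \<in> carrier R" "z [^] n = \<zero>" using assms by (rule nilpotentsE)
  \<comment> \<open>Here \<open>s\<close> is the sum of the first \<open>k\<close> powers of
    \<open>z\<close>, the empty sum 0 for \<open>k = 0\<close>. Both products are carried along
    because a unit needs a two-sided inverse.\<close>
  have "\<exists>s\<in>carrier R. (\<one> \<ominus> z) \<otimes> s = \<one> \<ominus> z [^] k \<and> s \<otimes> (\<one> \<ominus> z) = \<one> \<ominus> z [^] k" for k :: nat
  proof (induction k)
    case 0
    then show ?case using z by (intro bexI[of _ \<zero>]) (auto simp: minus_eq r_neg)
  next
    case (Suc k)
    then obtain s where s: "s \<in> carrier R" "(\<one> \<ominus> z) \<otimes> s = \<one> \<ominus> z [^] k"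
      "s \<otimes> (\<one> \<ominus> z) = \<one> \<ominus> z [^] k" by blast
    define p where "p = z [^] k"
    have p: "p \<in> carrier R" "z \<otimes> p = p \<otimes> z" "z [^] Suc k = p \<otimes> z"
      using z by (auto simp: p_def nat_pow_comm[of z 1 k, simplified])
    have "(\<one> \<ominus> z) \<otimes> (s \<oplus> p) = \<one> \<ominus> p \<otimes> z"
    proof -
      have "(\<one> \<ominus> z) \<otimes> (s \<oplus> p) = (\<one> \<ominus> z) \<otimes> s \<oplus> (p \<ominus> z \<otimes> p)"
        using z s(1) p by (simp add: r_distr l_distr minus_eq l_minus)
      also have "\<dots> = \<one> \<ominus> p \<otimes> z" unfolding s(2) p_def[symmetric] p(2)
        using z p(1) by (simp add: minus_eq a_assoc r_neg1)
      finally show ?thesis .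
    qed
    moreover have "(s \<oplus> p) \<otimes> (\<one> \<ominus> z) = \<one> \<ominus> p \<otimes> z"
    proof -
      have "(s \<oplus> p) \<otimes> (\<one> \<ominus> z) = s \<otimes> (\<one> \<ominus> z) \<oplus> (p \<ominus> p \<otimes> z)"
        using z s(1) p by (simp add: r_distr l_distr minus_eq r_minus minus_add a_ac)
      also have "\<dots> = \<one> \<ominus> p \<otimes> z" unfolding s(3) p_def[symmetric]
        using z p(1) by (simp add: minus_eq a_assoc r_neg1)
      finally show ?thesis .
    qed
    ultimately show ?case using s p by (intro bexI[of _ "s \<oplus> p"]) auto
  qed
  from this[of n] obtain s where "s \<in> carrier R" "(\<one> \<ominus> z) \<otimes> s = \<one>" "s \<otimes> (\<one> \<ominus> z) = \<one>"
    using z by (auto simp: minus_eq)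
  then show ?thesis using z unfolding Units_def by auto
qed

lemma one_plus_nilpotent_Units:
  assumes "z \<in> nilpotents R"
  shows "\<one> \<oplus> z \<in> Units R"
  using one_minus_nilpotent_Units[OF nilpotent_uminus[OF assms]] nilpotents_closed[OF assms]
  by (simp add: minus_eq)

text \<open>Substituting the equation into itself gives \<open>n = m^j n n^j\<close> for every
  \<open>j\<close>, and the right side vanishes once \<open>n^j = 0\<close>.\<close>

lemma nilpotent_eq_zero:
  assumes "n \<in> nilpotents R" "m \<in> carrier R" "n = m \<otimes> n \<otimes> n"
  shows "n = \<zero>"
proof -
  obtain k :: nat where n: "n \<in> carrier R" "n [^] k = \<zero>" using assms(1) by (rule nilpotentsE)
  have "m [^] j \<otimes> n \<otimes> n [^] j = n" for j :: nat
  proof (induction j)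
    case (Suc j)
    have "m [^] Suc j = m [^] j \<otimes> m" "n [^] Suc j = n \<otimes> n [^] j"
      using n by (simp, intro nat_pow_Suc2)
    then have "m [^] Suc j \<otimes> n \<otimes> n [^] Suc j = m [^] j \<otimes> (m \<otimes> n \<otimes> n) \<otimes> n [^] j"
      using n assms(2) by (simp add: m_assoc del: nat_pow_Suc)
    then show ?case unfolding assms(3)[symmetric] Suc .
  qed (use n in simp)
  from this[of k] show ?thesis using n assms(2) by simp
qed

subsection \<open>Left ideals\<close>

lemma left_ideal_subset: "left_ideal I R \<Longrightarrow> I \<subseteq> carrier R"
  unfolding left_ideal_def by (auto dest: additive_subgroup.a_subset)

lemma left_idealI:
  assumes "I \<subseteq> carrier R" "\<zero> \<in> I"
    and "\<And>x y. x \<in> I \<Longrightarrow> y \<in> I \<Longrightarrow> x \<oplus> y \<in> I"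
    and "\<And>r x. r \<in> carrier R \<Longrightarrow> x \<in> I \<Longrightarrow> r \<otimes> x \<in> I"
  shows "left_ideal I R"
proof -
  have "\<ominus> x \<in> I" if "x \<in> I" for x
    using assms(4)[of "\<ominus> \<one>" x] that assms(1) by (auto simp: l_minus)
  then have "additive_subgroup I R"
    using assms(1-3) by unfold_locales (auto simp: a_inv_def)
  then show ?thesis using assms(4) unfolding left_ideal_def by auto
qed

lemma left_ideal_zero: "left_ideal I R \<Longrightarrow> \<zero> \<in> I"
  and left_ideal_add: "left_ideal I R \<Longrightarrow> x \<in> I \<Longrightarrow> y \<in> I \<Longrightarrow> x \<oplus> y \<in> I"
  and left_ideal_mult: "left_ideal I R \<Longrightarrow> x \<in> I \<Longrightarrow> r \<in> carrier R \<Longrightarrow> r \<otimes> x \<in> I"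
  unfolding left_ideal_def
  by (auto intro: additive_subgroup.zero_closed additive_subgroup.a_closed)

lemma left_ideal_minus:
  assumes "left_ideal I R" "x \<in> I" "y \<in> I"
  shows "x \<ominus> y \<in> I"
  using left_ideal_add[OF assms(1,2) left_ideal_mult[OF assms(1,3), of "\<ominus> \<one>"]]
    left_ideal_subset[OF assms(1)] assms(2,3) by (auto simp: minus_eq l_minus subset_iff)

lemma left_ideal_one:
  assumes "left_ideal I R" "\<one> \<in> I"
  shows "I = carrier R"
  using left_ideal_subset[OF assms(1)] left_ideal_mult[OF assms] by force

lemma left_ideal_principal:
  assumes "a \<in> carrier R"
  shows "left_ideal ((\<lambda>r. r \<otimes> a) ` carrier R) R"
proof (rule left_idealI)
  show "\<zero> \<in> (\<lambda>r. r \<otimes> a) ` carrier R" using assms by (intro image_eqI[of _ _ \<zero>]) auto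
next
  fix x y assume "x \<in> (\<lambda>r. r \<otimes> a) ` carrier R" "y \<in> (\<lambda>r. r \<otimes> a) ` carrier R"
  then obtain r s where "r \<in> carrier R" "s \<in> carrier R" "x = r \<otimes> a" "y = s \<otimes> a" by blast
  then show "x \<oplus> y \<in> (\<lambda>r. r \<otimes> a) ` carrier R"
    using assms by (intro image_eqI[of _ _ "r \<oplus> s"]) (auto simp: l_distr)
next
  fix r x assume "r \<in> carrier R" "x \<in> (\<lambda>r. r \<otimes> a) ` carrier R"
  then obtain s where "r \<in> carrier R" "s \<in> carrier R" "x = s \<otimes> a" by blast
  then show "r \<otimes> x \<in> (\<lambda>r. r \<otimes> a) ` carrier R"
    using assms by (intro image_eqI[of _ _ "r \<otimes> s"]) (auto simp: m_assoc)
qed (use assms in auto)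

lemma left_ideal_sum:
  assumes I: "left_ideal I R" and K: "left_ideal K R"
  shows "left_ideal (I <+>\<^bsub>R\<^esub> K) R"
proof (rule left_idealI)
  note sub = left_ideal_subset[OF I] left_ideal_subset[OF K]
  show "I <+>\<^bsub>R\<^esub> K \<subseteq> carrier R" using sub by (auto simp: set_add_def' subset_iff)
  show "\<zero> \<in> I <+>\<^bsub>R\<^esub> K" using left_ideal_zero[OF I] left_ideal_zero[OF K]
    by (auto simp: set_add_def' intro!: bexI[of _ \<zero>])
next
  note sub = left_ideal_subset[OF I] left_ideal_subset[OF K]
  fix x y assume "x \<in> I <+>\<^bsub>R\<^esub> K" "y \<in> I <+>\<^bsub>R\<^esub> K"
  then obtain i k i' k' where *: "i \<in> I" "i' \<in> I" "k \<in> K" "k' \<in> K" "x = i \<oplus> k" "y = i' \<oplus> k'"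
    by (auto simp: set_add_def')
  then have "x \<oplus> y = (i \<oplus> i') \<oplus> (k \<oplus> k')" using sub by (simp add: subset_iff a_ac)
  then show "x \<oplus> y \<in> I <+>\<^bsub>R\<^esub> K"
    using * left_ideal_add[OF I, of i i'] left_ideal_add[OF K, of k k'] unfolding set_add_def' by blast
next
  note sub = left_ideal_subset[OF I] left_ideal_subset[OF K]
  fix r x assume r: "r \<in> carrier R" and "x \<in> I <+>\<^bsub>R\<^esub> K"
  then obtain i k where *: "i \<in> I" "k \<in> K" "x = i \<oplus> k" by (auto simp: set_add_def')
  then have "r \<otimes> x = r \<otimes> i \<oplus> r \<otimes> k" using sub r by (simp add: subset_iff r_distr)
  then show "r \<otimes> x \<in> I <+>\<^bsub>R\<^esub> K"
    using * r left_ideal_mult[OF I, of i r] left_ideal_mult[OF K, of k r] unfolding set_add_def' by blast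
qed

text \<open>Zorn's lemma for the left ideals above \<open>I\<close> that avoid 1. A left ideal is
  proper exactly when it avoids 1, and in this form properness clearly survives unions of
  chains.\<close>

lemma left_ideal_in_maximal:
  assumes I: "left_ideal I R" and "\<one> \<notin> I"
  obtains M where "maximal_left_ideal M R" "I \<subseteq> M"
proof -
  define S where "S = {K. left_ideal K R \<and> I \<subseteq> K \<and> \<one> \<notin> K}"
  have "\<exists>M\<in>S. \<forall>K\<in>S. M \<subseteq> K \<longrightarrow> K = M"
  proof (rule subset_Zorn_nonempty)
    show "S \<noteq> {}" using assms unfolding S_def by auto
    fix C assume C: "C \<noteq> {}" "subset.chain S C"
    have CS: "C \<subseteq> S" and tot: "\<forall>A\<in>C. \<forall>B\<in>C. A \<subseteq> B \<or> B \<subseteq> A"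
      using C(2) unfolding subset_chain_def by blast+
    have CI: "left_ideal A R" "I \<subseteq> A" "\<one> \<notin> A" if "A \<in> C" for A
      using subsetD[OF CS that] by (simp_all add: S_def)
    have "left_ideal (\<Union>C) R"
    proof (rule left_idealI)
      show "\<Union>C \<subseteq> carrier R" using left_ideal_subset[OF CI(1)] by auto
      show "\<zero> \<in> \<Union>C" using C(1) left_ideal_zero[OF CI(1)] by auto
      show "r \<otimes> x \<in> \<Union>C" if "r \<in> carrier R" "x \<in> \<Union>C" for r x
        using that left_ideal_mult[OF CI(1)] by auto
      fix x y assume "x \<in> \<Union>C" "y \<in> \<Union>C"
      then obtain A B where AB: "A \<in> C" "B \<in> C" "x \<in> A" "y \<in> B" by blast
      then obtain K where "K \<in> C" "x \<in> K" "y \<in> K"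
        using tot[rule_format, OF AB(1,2)] by (auto dest: subsetD)
      then show "x \<oplus> y \<in> \<Union>C" using left_ideal_add[OF CI(1)] by auto
    qed
    moreover obtain A where "A \<in> C" using C(1) by auto
    ultimately show "\<Union>C \<in> S" using CI(2,3) by (auto simp: S_def)
  qed
  then obtain M where MS: "M \<in> S" and max: "\<forall>K\<in>S. M \<subseteq> K \<longrightarrow> K = M" by blast
  then have M: "left_ideal M R" "I \<subseteq> M" "\<one> \<notin> M" by (auto simp: S_def)
  have "maximal_left_ideal M R"
    unfolding maximal_left_ideal_def
  proof (intro conjI allI impI)
    show "M \<noteq> carrier R" using M(3) by auto
    fix K assume K: "left_ideal K R \<and> M \<subseteq> K"
    show "K = M \<or> K = carrier R"
    proof (cases "\<one> \<in> K")
      case True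
      then show ?thesis using K left_ideal_one by simp
    next
      case False
      then show ?thesis using K M(2) max by (auto simp: S_def)
    qed
  qed (rule M)
  then show ?thesis using that M(2) by simp
qed

lemma left_ideal_jacobson_radical: "left_ideal (jacobson_radical R) R"
proof (rule left_idealI)
  have max: "left_ideal M R" if "maximal_left_ideal M R" for M
    using that by (simp add: maximal_left_ideal_def)
  show "\<zero> \<in> jacobson_radical R" "jacobson_radical R \<subseteq> carrier R"
    using left_ideal_zero max unfolding jacobson_radical_def by auto
  show "x \<oplus> y \<in> jacobson_radical R" if "x \<in> jacobson_radical R" "y \<in> jacobson_radical R" for x y
    using that left_ideal_add max unfolding jacobson_radical_def by auto
  show "r \<otimes> x \<in> jacobson_radical R" if "r \<in> carrier R" "x \<in> jacobson_radical R" for r x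
    using that left_ideal_mult max unfolding jacobson_radical_def by auto
qed

text \<open>If \<open>e\<close> is nonzero, \<open>R(1 - e)\<close> is proper, since
  \<open>1 = r(1 - e)\<close> multiplied by \<open>e\<close> on the right gives
  \<open>e = 0\<close>. A maximal left ideal above it would contain both \<open>1 - e\<close> and
  \<open>e\<close>, hence 1.\<close>

lemma idempotent_in_jacobson_radical:
  assumes "e \<in> jacobson_radical R" "e \<otimes> e = e"
  shows "e = \<zero>"
proof (rule ccontr)
  assume "e \<noteq> \<zero>"
  have e: "e \<in> carrier R" using assms(1) unfolding jacobson_radical_def by auto
  let ?I = "(\<lambda>r. r \<otimes> (\<one> \<ominus> e)) ` carrier R"
  have I: "left_ideal ?I R" using e by (intro left_ideal_principal) auto
  have "\<one> \<notin> ?I"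
  proof
    assume "\<one> \<in> ?I"
    then obtain r where r: "r \<in> carrier R" "\<one> = r \<otimes> (\<one> \<ominus> e)" by blast
    have "e = r \<otimes> (\<one> \<ominus> e) \<otimes> e" using e by (simp add: r(2)[symmetric])
    also have "\<dots> = r \<otimes> (e \<ominus> e \<otimes> e)"
      using e r(1) by (simp add: m_assoc l_distr minus_eq l_minus)
    also have "\<dots> = \<zero>" using e r(1) by (simp add: assms(2) minus_eq r_neg)
    finally show False using \<open>e \<noteq> \<zero>\<close> by simp
  qed
  then obtain M where M: "maximal_left_ideal M R" "?I \<subseteq> M"
    using left_ideal_in_maximal[OF I] by blast
  then have "\<one> \<ominus> e \<in> M" using e by (force intro!: image_eqI[of _ _ \<one>])
  moreover have "e \<in> M" using assms(1) M(1) unfolding jacobson_radical_def by auto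
  ultimately have "(\<one> \<ominus> e) \<oplus> e \<in> M" using M(1) left_ideal_add unfolding maximal_left_ideal_def by blast
  then have "\<one> \<in> M" using e by (simp add: minus_eq a_assoc l_neg)
  then show False using M(1) left_ideal_one unfolding maximal_left_ideal_def by blast
qed

text \<open>If a maximal left ideal \<open>M\<close> misses \<open>a\<close>, then
  \<open>M + Ra = R\<close>, so \<open>1 = m + r a\<close> with \<open>m\<close> in
  \<open>M\<close>. But \<open>m = 1 - r a\<close> is a unit because \<open>r a\<close> is
  nilpotent.\<close>

lemma nil_left_ideal_in_jacobson_radical:
  assumes a: "a \<in> carrier R" and nil: "\<And>x. x \<in> carrier R \<Longrightarrow> x \<otimes> a \<in> nilpotents R"
  shows "a \<in> jacobson_radical R"
proof -
  have "a \<in> M" if M: "maximal_left_ideal M R" for M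
  proof (rule ccontr)
    assume "a \<notin> M"
    have lM: "left_ideal M R" using M by (simp add: maximal_left_ideal_def)
    let ?I = "(\<lambda>r. r \<otimes> a) ` carrier R"
    have I: "left_ideal ?I R" using a by (rule left_ideal_principal)
    have "a \<in> ?I" using a by (force intro!: image_eqI[of _ _ \<one>])
    have MI: "M \<subseteq> M <+>\<^bsub>R\<^esub> ?I" "a \<in> M <+>\<^bsub>R\<^esub> ?I"
      using left_ideal_zero[OF lM] left_ideal_zero[OF I] \<open>a \<in> ?I\<close> left_ideal_subset[OF lM] a
      unfolding set_add_def' by (force simp: subset_iff)+
    then have "M <+>\<^bsub>R\<^esub> ?I = carrier R"
      using M left_ideal_sum[OF lM I] \<open>a \<notin> M\<close> unfolding maximal_left_ideal_def by blast
    then have "\<one> \<in> M <+>\<^bsub>R\<^esub> ?I" by simp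
    then obtain m r where mr: "m \<in> M" "r \<in> carrier R" "\<one> = m \<oplus> r \<otimes> a"
      by (auto simp: set_add_def')
    have mc: "m \<in> carrier R" using mr left_ideal_subset[OF lM] by auto
    have "m = \<one> \<ominus> r \<otimes> a" unfolding mr(3) using mc mr a by (simp add: minus_eq a_assoc r_neg)
    then have "m \<in> Units R" using one_minus_nilpotent_Units[OF nil[OF mr(2)]] by (simp only:)
    then have "\<one> \<in> M" using left_ideal_mult[OF lM mr(1), of "inv m"] by auto
    then show False using M left_ideal_one unfolding maximal_left_ideal_def by blast
  qed
  then show ?thesis using a unfolding jacobson_radical_def by auto
qed

subsection \<open>The Jacobson radical of a semipotent ring with nil radical\<close>

text \<open>A non-nilpotent element of the radical would have a nonzero idempotent left multiple,
  again in the radical.\<close>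

lemma jacobson_radical_nil:
  assumes "nil_semipotent R"
  shows "jacobson_radical R \<subseteq> nilpotents R"
proof (rule subsetI, rule ccontr)
  fix t assume t: "t \<in> jacobson_radical R" "t \<notin> nilpotents R"
  then have "t \<in> carrier R - nilpotents R" by (simp add: jacobson_radical_def)
  then obtain z where z: "z \<in> carrier R" "z \<otimes> t \<noteq> \<zero>" "(z \<otimes> t) \<otimes> (z \<otimes> t) = z \<otimes> t"
    using assms unfolding nil_semipotent_def by blast
  then show False
    using idempotent_in_jacobson_radical left_ideal_mult[OF left_ideal_jacobson_radical t(1)] by blast
qed

text \<open>Being defined by maximal left ideals, the radical is at first only a left ideal. As it
  is nil, \<open>r x a\<close> is nilpotent, hence so is \<open>x a r\<close> for every
  \<open>x\<close>, and the nil criterion applies to \<open>a r\<close>.\<close>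

lemma jacobson_radical_mult_right:
  assumes "nil_semipotent R" "a \<in> jacobson_radical R" "r \<in> carrier R"
  shows "a \<otimes> r \<in> jacobson_radical R"
proof (rule nil_left_ideal_in_jacobson_radical)
  have a: "a \<in> carrier R" using assms(2) by (simp add: jacobson_radical_def)
  show "a \<otimes> r \<in> carrier R" using a assms(3) by simp
  fix x assume x: "x \<in> carrier R"
  have "(r \<otimes> x) \<otimes> a \<in> nilpotents R"
    using jacobson_radical_nil[OF assms(1)] left_ideal_mult[OF left_ideal_jacobson_radical assms(2)]
      assms(3) x by blast
  then have "r \<otimes> (x \<otimes> a) \<in> nilpotents R" using x a assms(3) by (simp add: m_assoc)
  then show "x \<otimes> (a \<otimes> r) \<in> nilpotents R"
    using nilpotent_mult_swap[of r "x \<otimes> a"] x a assms(3) by (simp add: m_assoc)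
qed

text \<open>A power of \<open>z\<close> lying in the nil radical is nilpotent, and then so is
  \<open>z\<close>; conversely the radical contains 0.\<close>

lemma jacobson_sharp_eq_nilpotents:
  assumes "nil_semipotent R"
  shows "jacobson_sharp R = nilpotents R"
proof
  show "nilpotents R \<subseteq> jacobson_sharp R"
    using left_ideal_zero[OF left_ideal_jacobson_radical]
    unfolding nilpotents_def jacobson_sharp_def by auto
  show "jacobson_sharp R \<subseteq> nilpotents R"
  proof
    fix z assume "z \<in> jacobson_sharp R"
    then obtain n :: nat where z: "z \<in> carrier R" "z [^] n \<in> nilpotents R"
      using jacobson_radical_nil[OF assms] unfolding jacobson_sharp_def by auto
    then obtain k :: nat where "(z [^] n) [^] k = \<zero>" by (auto elim: nilpotentsE)
    then show "z \<in> nilpotents R" using z by (intro nilpotentsI[of _ "n * k"]) (auto simp: nat_pow_pow)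
  qed
qed

subsection \<open>Chain conditions\<close>

text \<open>The descending chain condition recast as a minimum condition: strict inclusion of left
  ideals is well-founded.\<close>

lemma left_artinian_minimal:
  assumes art: "left_artinian R" and "left_ideal I R" "P I"
  obtains L where "left_ideal L R" "L \<subseteq> I" "P L"
    "\<And>K. left_ideal K R \<Longrightarrow> K \<subseteq> L \<Longrightarrow> P K \<Longrightarrow> K = L"
proof -
  let ?r = "{(K, L). left_ideal K R \<and> left_ideal L R \<and> K \<subset> L}"
  have "wf ?r"
    unfolding wf_iff_no_infinite_down_chain
  proof
    assume "\<exists>f. \<forall>i. (f (Suc i), f i) \<in> ?r"
    then obtain f where "\<forall>i. (f (Suc i), f i) \<in> ?r" ..
    then have f: "left_ideal (f i) R" "f (Suc i) \<subset> f i" for i by auto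
    then obtain N where "\<And>n. n \<ge> N \<Longrightarrow> f n = f N"
      using art unfolding left_artinian_def by blast
    then show False using f(2)[of N] by (metis le_SucI order_refl psubset_eq)
  qed
  moreover have "I \<in> {K. left_ideal K R \<and> K \<subseteq> I \<and> P K}" using assms by auto
  ultimately obtain L where L: "L \<in> {K. left_ideal K R \<and> K \<subseteq> I \<and> P K}"
    and min: "\<And>K. (K, L) \<in> ?r \<Longrightarrow> K \<notin> {K. left_ideal K R \<and> K \<subseteq> I \<and> P K}"
    by (rule wfE_min) blast
  show ?thesis by (rule that[of L]) (use L min in auto)
qed

text \<open>Expanding \<open>(e - e\<^sup>2)\<^sup>m = 0\<close> gives \<open>E = E\<^sup>2 g\<close> for \<open>E = e\<^sup>m\<close> and some \<open>g\<close> commuting with \<open>e\<close>;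
  the idempotent is \<open>g E\<close>.\<close>

lemma idempotent_lift:
  assumes e: "e \<in> carrier R" "e \<notin> nilpotents R" and "e \<ominus> e \<otimes> e \<in> nilpotents R"
  obtains z where "z \<in> carrier R" "z \<otimes> e \<noteq> \<zero>" "(z \<otimes> e) \<otimes> (z \<otimes> e) = z \<otimes> e"
proof -
  obtain m :: nat where m: "(e \<ominus> e \<otimes> e) [^] m = \<zero>" using assms(3) by (rule nilpotentsE)
  have "\<exists>p\<in>carrier R. p \<otimes> e = e \<otimes> p \<and> (e \<ominus> e \<otimes> e) [^] k = e [^] k \<otimes> (\<one> \<ominus> e \<otimes> p)" for k :: nat
  proof (induction k)
    case 0
    then show ?case using e by (intro bexI[of _ \<zero>]) (auto simp: minus_eq)
  next
    case (Suc k)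
    then obtain p where p: "p \<in> carrier R" "p \<otimes> e = e \<otimes> p"
      "(e \<ominus> e \<otimes> e) [^] k = e [^] k \<otimes> (\<one> \<ominus> e \<otimes> p)" by blast
    have pe: "p \<otimes> (e \<otimes> x) = e \<otimes> (p \<otimes> x)" if "x \<in> carrier R" for x
      using p(1,2) e that by (simp add: m_assoc[symmetric])
    \<comment> \<open>Chosen so that \<open>1 - e q = (1 - e p)(1 - e)\<close>, while
      \<open>e - e^2 = e (1 - e)\<close> supplies the further factor.\<close>
    define q where "q = \<one> \<oplus> p \<ominus> p \<otimes> e"
    have q: "q \<in> carrier R" "q \<otimes> e = e \<otimes> q"
      using e p(1) unfolding q_def
      by (auto simp: minus_eq l_distr r_distr l_minus r_minus m_assoc p(2) pe)
    have "(\<one> \<ominus> e \<otimes> p) \<otimes> (e \<ominus> e \<otimes> e) = e \<otimes> (\<one> \<ominus> e \<otimes> q)"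
      using e p(1) unfolding q_def
      by (simp add: minus_eq l_distr r_distr l_minus r_minus m_assoc p(2) pe minus_add a_ac)
    then have "(e \<ominus> e \<otimes> e) [^] Suc k = e [^] Suc k \<otimes> (\<one> \<ominus> e \<otimes> q)"
      using e p q by (simp add: m_assoc)
    then show ?case using q by blast
  qed
  \<comment> \<open>The exponent is \<open>Suc m\<close> rather than \<open>m\<close> so that
    \<open>E\<close> ends in a factor \<open>e\<close>, which makes \<open>g E\<close> a left
    multiple of \<open>e\<close>.\<close>
  from this[of "Suc m"] obtain p where p: "p \<in> carrier R" "p \<otimes> e = e \<otimes> p"
    "e [^] Suc m \<otimes> (\<one> \<ominus> e \<otimes> p) = \<zero>" using m e by (metis minus_closed m_closed l_null nat_pow_Suc)
  define E where "E = e [^] Suc m"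
  define g where "g = p [^] Suc m"
  have E: "E \<in> carrier R" and g: "g \<in> carrier R" using e p by (auto simp: E_def g_def)
  have "E \<otimes> (e \<otimes> p) = E"
    using p(1,3) e E unfolding E_def[symmetric]
    by (simp add: minus_eq r_distr r_minus) (simp add: minus_eq[symmetric])
  then have "E \<otimes> (e \<otimes> p) [^] k = E" for k :: nat
    by (induction k) (use E e p(1) in \<open>auto simp: m_assoc[symmetric]\<close>)
  \<comment> \<open>Since \<open>e\<close> and \<open>p\<close> commute, \<open>(e p)^(m+1)\<close>
    equals \<open>E g\<close>.\<close>
  from this[of "Suc m"] have EEg: "E \<otimes> (E \<otimes> g) = E"
    using pow_mult_distrib[of e p "Suc m"] e p by (simp only: E_def g_def)
  have gE: "g \<otimes> E = E \<otimes> g"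
    using pow_mult_distrib[of e p "Suc m"] pow_mult_distrib[of p e "Suc m"] e p
    by (simp only: E_def g_def)
  have "g \<otimes> e [^] m \<otimes> e = g \<otimes> E" using e g by (simp add: E_def m_assoc)
  moreover have "g \<otimes> E \<noteq> \<zero>"
  proof
    assume "g \<otimes> E = \<zero>"
    then have "E = \<zero>" using EEg gE E by simp
    then show False using e nilpotentsI unfolding E_def by blast
  qed
  moreover have "(g \<otimes> E) \<otimes> (g \<otimes> E) = g \<otimes> E"
    using E g EEg by (simp add: m_assoc gE[symmetric])
  ultimately show ?thesis using that[of "g \<otimes> e [^] m"] e g by simp
qed

text \<open>Let \<open>L\<close> be minimal among the left ideals inside \<open>Rt\<close> that are
  not nil, and \<open>s\<close> in \<open>L\<close> not nilpotent. Then \<open>s^2\<close> is not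
  nilpotent either, so \<open>R s^2 = L\<close> and \<open>s = r s^2\<close>. The element
  \<open>e = r s\<close> fixes \<open>s\<close> from the left and is idempotent up to a nilpotent,
  so the lifting lemma applies.\<close>

lemma left_artinian_nil_semipotent:
  assumes "left_artinian R"
  shows "nil_semipotent R"
  unfolding nil_semipotent_def
proof
  fix t assume t: "t \<in> carrier R - nilpotents R"
  let ?I = "(\<lambda>r. r \<otimes> t) ` carrier R"
  have "left_ideal ?I R" "\<not> ?I \<subseteq> nilpotents R"
    using t by (auto intro!: left_ideal_principal image_eqI[of _ _ \<one>])
  from left_artinian_minimal[OF assms this(1), of "\<lambda>K. \<not> K \<subseteq> nilpotents R", OF this(2)]
  obtain L where L: "left_ideal L R" "L \<subseteq> ?I" "\<not> L \<subseteq> nilpotents R"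
    "\<And>K. left_ideal K R \<Longrightarrow> K \<subseteq> L \<Longrightarrow> \<not> K \<subseteq> nilpotents R \<Longrightarrow> K = L" by blast
  then obtain s where s: "s \<in> L" "s \<notin> nilpotents R" by blast
  have sc: "s \<in> carrier R" using s(1) left_ideal_subset[OF L(1)] by blast
  have "s \<otimes> s \<notin> nilpotents R"
  proof
    assume "s \<otimes> s \<in> nilpotents R"
    then obtain n :: nat where "(s \<otimes> s) [^] n = \<zero>" by (rule nilpotentsE)
    moreover have "s \<otimes> s = s [^] (2::nat)" using sc by (simp add: numeral_2_eq_2)
    ultimately have "s [^] (2 * n) = \<zero>" using nat_pow_pow[OF sc, of 2 n] by simp
    then show False using s(2) nilpotentsI[OF sc] by blast
  qed
  then have "\<one> \<otimes> (s \<otimes> s) \<notin> nilpotents R" using sc by simp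
  then have "\<not> (\<lambda>r. r \<otimes> (s \<otimes> s)) ` carrier R \<subseteq> nilpotents R" by blast
  moreover have "(\<lambda>r. r \<otimes> (s \<otimes> s)) ` carrier R \<subseteq> L"
    using left_ideal_mult[OF L(1) s(1)] sc by (auto simp: m_assoc[symmetric])
  ultimately have "(\<lambda>r. r \<otimes> (s \<otimes> s)) ` carrier R = L"
    using L(4) left_ideal_principal sc by simp
  with s(1) obtain r where r: "r \<in> carrier R" "s = r \<otimes> (s \<otimes> s)" by blast
  define e where "e = r \<otimes> s"
  have e: "e \<in> L" "e \<in> carrier R" "e \<otimes> s = s"
    using left_ideal_mult[OF L(1) s(1)] r(1) r(2)[symmetric] sc by (auto simp: e_def m_assoc)
  text \<open>The annihilator of \<open>s\<close> in \<open>L\<close> is nil by minimality and contains \<open>e - e\<^sup>2\<close>.\<close>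
  let ?N = "{l \<in> L. l \<otimes> s = \<zero>}"
  have N: "left_ideal ?N R"
  proof (rule left_idealI)
    show "?N \<subseteq> carrier R" using left_ideal_subset[OF L(1)] by auto
    show "\<zero> \<in> ?N" using left_ideal_zero[OF L(1)] sc by simp
    show "x \<oplus> y \<in> ?N" if "x \<in> ?N" "y \<in> ?N" for x y
      using that left_ideal_add[OF L(1)] left_ideal_subset[OF L(1)] sc by (auto simp: l_distr subset_iff)
    show "c \<otimes> x \<in> ?N" if "c \<in> carrier R" "x \<in> ?N" for c x
      using that left_ideal_mult[OF L(1)] left_ideal_subset[OF L(1)] sc by (auto simp: m_assoc subset_iff)
  qed
  have "?N \<noteq> L"
  proof
    assume "?N = L"
    then have "s \<otimes> s = \<zero>" using s(1) by blast
    then have "s [^] (2::nat) = \<zero>" using sc by (simp add: numeral_2_eq_2)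
    then show False using s(2) nilpotentsI[OF sc] by blast
  qed
  then have "?N \<subseteq> nilpotents R" using L(4)[OF N] by blast
  moreover have "e \<ominus> e \<otimes> e \<in> ?N"
    using e sc left_ideal_minus[OF L(1) e(1) left_ideal_mult[OF L(1) e(1,2)]]
    by (simp add: minus_eq l_distr l_minus m_assoc r_neg)
  moreover have "e \<notin> nilpotents R"
  proof
    assume "e \<in> nilpotents R"
    then obtain k :: nat where k: "e [^] k = \<zero>" by (rule nilpotentsE)
    have "e [^] j \<otimes> s = s" for j :: nat
      by (induction j) (use e sc in \<open>auto simp: m_assoc\<close>)
    from this[of k] have "s = \<zero>" using k sc by simp
    then show False using s(2) nilpotentsI[of \<zero> 1] by simp
  qed
  ultimately obtain z where z: "z \<in> carrier R" "z \<otimes> e \<noteq> \<zero>" "(z \<otimes> e) \<otimes> (z \<otimes> e) = z \<otimes> e"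
    using idempotent_lift[OF e(2)] by blast
  \<comment> \<open>Since \<open>L\<close> lies in \<open>Rt\<close>, a left multiple of
    \<open>e\<close> is also one of \<open>t\<close>.\<close>
  obtain c where "c \<in> carrier R" "e = c \<otimes> t" using e(1) L(2) by blast
  then show "\<exists>z\<in>carrier R. z \<otimes> t \<noteq> \<zero> \<and> (z \<otimes> t) \<otimes> (z \<otimes> t) = z \<otimes> t"
    using z t by (intro bexI[of _ "z \<otimes> c"]) (auto simp: m_assoc)
qed

text \<open>A descending chain is constant from a term of least cardinality on.\<close>

lemma finite_left_artinian:
  assumes "finite (carrier R)"
  shows "left_artinian R"
  unfolding left_artinian_def
proof (intro allI impI)
  fix I :: "nat \<Rightarrow> 'a set"
  assume I: "\<forall>n. left_ideal (I n) R \<and> I (Suc n) \<subseteq> I n"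
  have anti: "I n \<subseteq> I m" if "m \<le> n" for m n
    using I lift_Suc_antimono_le[of I, OF _ that] by simp
  have fin: "finite (I n)" for n by (rule finite_subset[OF left_ideal_subset assms]) (use I in simp)
  obtain N where "\<And>n. card (I N) \<le> card (I n)"
    using ex_has_least_nat[of "\<lambda>_. True" 0 "\<lambda>n. card (I n)"] by auto
  then have "I n = I N" if "n \<ge> N" for n
    using card_seteq[OF fin anti[OF that]] by simp
  then show "\<exists>N. \<forall>n\<ge>N. I n = I N" by blast
qed

end

section \<open>Right Artinian rings via the opposite ring\<close>

definition opposite_ring :: "('a, 'b) ring_scheme \<Rightarrow> ('a, 'b) ring_scheme"
  where "opposite_ring R = R\<lparr>mult := \<lambda>x y. y \<otimes>\<^bsub>R\<^esub> x\<rparr>"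

lemma opposite_ring_simps [simp]:
  "carrier (opposite_ring R) = carrier R"
  "x \<otimes>\<^bsub>opposite_ring R\<^esub> y = y \<otimes>\<^bsub>R\<^esub> x"
  "\<one>\<^bsub>opposite_ring R\<^esub> = \<one>\<^bsub>R\<^esub>"
  "\<zero>\<^bsub>opposite_ring R\<^esub> = \<zero>\<^bsub>R\<^esub>"
  "add (opposite_ring R) = add R"
  by (simp_all add: opposite_ring_def)

context ring
begin

lemma ring_opposite_ring: "ring (opposite_ring R)"
proof (rule ringI)
  show "abelian_group (opposite_ring R)"
    using abelian_group_axioms
    by (simp add: abelian_group_def abelian_monoid_def abelian_group_axioms_def)
  show "monoid (opposite_ring R)" by (rule monoidI) (simp_all add: m_assoc)
qed (simp_all add: l_distr r_distr)

lemma opposite_ring_pow: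
  assumes "x \<in> carrier R"
  shows "x [^]\<^bsub>opposite_ring R\<^esub> (n::nat) = x [^] n"
proof (induction n)
  case (Suc n)
  have "x [^]\<^bsub>opposite_ring R\<^esub> Suc n = x \<otimes> x [^]\<^bsub>opposite_ring R\<^esub> n"
    by (simp add: nat_pow_def)
  then show ?case using Suc nat_pow_Suc2[OF assms] by simp
qed (simp add: nat_pow_def)

lemma left_ideal_opposite_ring: "left_ideal I (opposite_ring R) = right_ideal I R"
  by (simp add: left_ideal_def right_ideal_def additive_subgroup_def)

text \<open>The left Artinian case in the opposite ring yields a nonzero idempotent right multiple
  \<open>t z\<close>, which must then be exchanged for a left multiple.\<close>

lemma right_artinian_nil_semipotent:
  assumes "right_artinian R"
  shows "nil_semipotent R"
proof -
  have "left_artinian (opposite_ring R)"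
    using assms left_ideal_opposite_ring unfolding left_artinian_def right_artinian_def by blast
  then have opp: "nil_semipotent (opposite_ring R)"
    using ring.left_artinian_nil_semipotent ring_opposite_ring by blast
  have nil: "nilpotents (opposite_ring R) = nilpotents R"
    unfolding nilpotents_def by (auto simp: opposite_ring_pow)
  show ?thesis
    unfolding nil_semipotent_def
  proof
    fix t assume t: "t \<in> carrier R - nilpotents R"
    then obtain z where z: "z \<in> carrier R" "t \<otimes> z \<noteq> \<zero>" "(t \<otimes> z) \<otimes> (t \<otimes> z) = t \<otimes> z"
      using opp nil unfolding nil_semipotent_def by auto
    \<comment> \<open>With \<open>w = z t z\<close> one has \<open>w t w = w\<close>, so
      \<open>w t\<close> is idempotent, and \<open>t (w t) z = t z\<close> shows that it is
      nonzero.\<close>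
    define w where "w = z \<otimes> t \<otimes> z"
    have tw: "t \<otimes> w = t \<otimes> z" using z t by (simp add: w_def m_assoc)
    have wc: "w \<in> carrier R" using z t by (simp add: w_def)
    have "w \<otimes> (t \<otimes> w) = w" unfolding tw using z t by (simp add: w_def m_assoc)
    moreover have "(w \<otimes> t) \<otimes> (w \<otimes> t) = (w \<otimes> (t \<otimes> w)) \<otimes> t" using wc t by (simp add: m_assoc)
    ultimately have "(w \<otimes> t) \<otimes> (w \<otimes> t) = w \<otimes> t" by simp
    moreover have "t \<otimes> (w \<otimes> t) \<otimes> z = t \<otimes> z" using z t by (simp add: w_def m_assoc)
    then have "w \<otimes> t \<noteq> \<zero>" using z t by auto
    ultimately show "\<exists>z\<in>carrier R. z \<otimes> t \<noteq> \<zero> \<and> (z \<otimes> t) \<otimes> (z \<otimes> t) = z \<otimes> t"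
      using wc by blast
  qed
qed

subsection \<open>Semipotent UU rings with nil radical\<close>

text \<open>The UU condition makes \<open>n\<close> nilpotent in
  \<open>(1 + y)(1 + b) = 1 + n\<close>. As an invertible 2 by 2 matrix, \<open>n\<close> also
  satisfies \<open>n = m n n\<close> for some \<open>m\<close>, so \<open>n = 0\<close>, against
  \<open>e n e = e\<close>.\<close>

lemma UU_square_zero_in_jacobson_radical:
  assumes P: "nil_semipotent R" and UU: "UU_ring R"
    and a: "a \<in> carrier R" "a \<otimes> a = \<zero>"
  shows "a \<in> jacobson_radical R"
proof (rule nil_left_ideal_in_jacobson_radical, rule a, rule ccontr)
  fix x assume x: "x \<in> carrier R" "x \<otimes> a \<notin> nilpotents R"
  then obtain v where v: "v \<in> carrier R" "v \<otimes> (x \<otimes> a) \<noteq> \<zero>"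
    "(v \<otimes> (x \<otimes> a)) \<otimes> (v \<otimes> (x \<otimes> a)) = v \<otimes> (x \<otimes> a)"
    using P a unfolding nil_semipotent_def by blast
  define w where "w = v \<otimes> x"
  define e where "e = w \<otimes> a"
  have w: "w \<in> carrier R" and e: "e \<in> carrier R" "e \<noteq> \<zero>" "e \<otimes> e = e"
    using v x a by (auto simp: w_def e_def m_assoc)
  text \<open>\<open>e\<close>, \<open>y\<close>, \<open>b\<close>, \<open>b y\<close> are the matrix units 11, 12, 21, 22, and \<open>n\<close> below is the matrix with
    rows (1,1), (1,0); its inverse \<open>b + y - b y\<close> has rows (0,1), (1,-1).\<close>
  define b where "b = a \<otimes> e"
  define y where "y = e \<otimes> w \<otimes> (\<one> \<ominus> e)"
  have bc: "b \<in> carrier R" and yc: "y \<in> carrier R" using a w e by (auto simp: b_def y_def)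
  have be: "b \<otimes> e = b" using a e by (simp add: b_def m_assoc)
  have eb: "e \<otimes> b = \<zero>"
  proof -
    have "e \<otimes> b = w \<otimes> (a \<otimes> a) \<otimes> e" using a(1) w e(1) unfolding b_def e_def by (simp add: m_assoc)
    then show ?thesis using a w e by simp
  qed
  have bb: "b \<otimes> b = \<zero>" using be eb bc e by (metis m_assoc r_null)
  have "(\<one> \<ominus> e) \<otimes> e = \<zero>" using e by (simp add: minus_eq l_distr l_minus r_neg)
  then have ye: "y \<otimes> e = \<zero>" using e w by (simp add: y_def m_assoc)
  have ey: "e \<otimes> y = y" using e w by (simp add: y_def m_assoc[symmetric])
  have yy: "y \<otimes> y = \<zero>" using ye ey yc e by (metis m_assoc l_null)
  \<comment> \<open>Because \<open>e b = 0\<close>, the factor \<open>1 - e\<close> of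
    \<open>y\<close> disappears in \<open>y b\<close>, which leaves
    \<open>e (w a) e = e\<close>.\<close>
  have "(\<one> \<ominus> e) \<otimes> b = b" using e bc eb by (simp add: minus_eq l_distr l_minus)
  then have "y \<otimes> b = e \<otimes> (w \<otimes> a) \<otimes> e" using e(1) w bc a by (simp add: y_def m_assoc) (simp add: b_def)
  then have yb: "y \<otimes> b = e" using e by (simp add: e_def[symmetric])
  define n where "n = y \<oplus> b \<oplus> e"
  have nc: "n \<in> carrier R" using bc yc e by (simp add: n_def)
  have "\<one> \<oplus> y \<in> Units R" "\<one> \<oplus> b \<in> Units R"
    using bc yc bb yy by (auto intro!: one_plus_nilpotent_Units nilpotentsI[of _ 2] simp: numeral_2_eq_2)
  then have "(\<one> \<oplus> y) \<otimes> (\<one> \<oplus> b) \<in> Units R" by (rule Units_m_closed)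
  moreover have "(\<one> \<oplus> y) \<otimes> (\<one> \<oplus> b) = \<one> \<oplus> n"
    using bc yc e yb by (simp add: n_def l_distr r_distr a_ac)
  ultimately have "\<one> \<oplus> n \<in> \<one> <+\<^bsub>R\<^esub> nilpotents R" using UU unfolding UU_ring_def by simp
  then obtain k where "k \<in> nilpotents R" "\<one> \<oplus> n = \<one> \<oplus> k" unfolding a_l_coset_def' by blast
  then have "n \<in> nilpotents R" using nc nilpotents_closed by auto
  \<comment> \<open>Multiplying \<open>n\<close> on the left by the inverse matrix gives
    \<open>b y + e\<close>, the identity matrix of the corner, which fixes \<open>n\<close>.\<close>
  moreover have "n = (b \<oplus> y \<ominus> b \<otimes> y) \<otimes> n \<otimes> n"
  proof -
    have "(b \<oplus> y) \<otimes> n = (b \<otimes> y \<oplus> e) \<oplus> b" "(b \<otimes> y) \<otimes> n = b"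
      using bc yc e(1) by (simp_all add: n_def l_distr r_distr m_assoc be bb ye yb yy a_ac)
    moreover have "(b \<oplus> y \<ominus> b \<otimes> y) \<otimes> n = (b \<oplus> y) \<otimes> n \<ominus> (b \<otimes> y) \<otimes> n"
      using bc yc nc by (simp only: minus_eq l_distr l_minus a_closed m_closed a_inv_closed)
    ultimately have "(b \<oplus> y \<ominus> b \<otimes> y) \<otimes> n = b \<otimes> y \<oplus> e"
      using bc yc e(1) by (simp add: minus_eq a_assoc r_neg)
    moreover have "(b \<otimes> y \<oplus> e) \<otimes> n = n"
      using bc yc e by (simp add: n_def l_distr r_distr m_assoc be ye yb yy ey eb a_ac)
    ultimately show ?thesis by simp
  qed
  ultimately have "n = \<zero>" using bc yc by (intro nilpotent_eq_zero[of n "b \<oplus> y \<ominus> b \<otimes> y"]) auto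
  \<comment> \<open>This is the 11 entry of \<open>n\<close>.\<close>
  have "e \<otimes> n \<otimes> e = e" using e bc yc by (simp add: n_def r_distr l_distr eb ey ye)
  then show False using \<open>n = \<zero>\<close> e by simp
qed

lemma UU_nilpotents_in_jacobson_radical:
  assumes P: "nil_semipotent R" and UU: "UU_ring R"
  shows "nilpotents R \<subseteq> jacobson_radical R"
proof
  note J = left_ideal_jacobson_radical
  fix a assume "a \<in> nilpotents R"
  then obtain n :: nat where a: "a \<in> carrier R" "a [^] n = \<zero>" by (rule nilpotentsE)
  show "a \<in> jacobson_radical R"
  proof (rule nil_left_ideal_in_jacobson_radical, rule a, rule ccontr)
    fix x assume x: "x \<in> carrier R" "x \<otimes> a \<notin> nilpotents R"
    then obtain v where v: "v \<in> carrier R" "v \<otimes> (x \<otimes> a) \<noteq> \<zero>"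
      "(v \<otimes> (x \<otimes> a)) \<otimes> (v \<otimes> (x \<otimes> a)) = v \<otimes> (x \<otimes> a)"
      using P a unfolding nil_semipotent_def by blast
    define w where "w = v \<otimes> x"
    define e where "e = w \<otimes> a"
    have w: "w \<in> carrier R" and e: "e \<in> carrier R" "e \<noteq> \<zero>" "e \<otimes> e = e"
      using v x a by (auto simp: w_def e_def m_assoc)
    text \<open>Idempotents are central modulo the radical, because \<open>e r (1 - e)\<close> and
      \<open>(1 - e) r e\<close> square to zero.\<close>
    have central: "e \<otimes> w \<ominus> w \<otimes> e \<in> jacobson_radical R"
    proof -
      define f where "f = \<one> \<ominus> e"
      have f: "f \<in> carrier R" "f \<otimes> e = \<zero>" "e \<otimes> f = \<zero>"
        using e by (auto simp: f_def minus_eq l_distr r_distr l_minus r_minus r_neg)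
      have "e \<otimes> w \<otimes> f \<otimes> (e \<otimes> w \<otimes> f) = e \<otimes> w \<otimes> (f \<otimes> e) \<otimes> w \<otimes> f"
        "f \<otimes> w \<otimes> e \<otimes> (f \<otimes> w \<otimes> e) = f \<otimes> w \<otimes> (e \<otimes> f) \<otimes> w \<otimes> e"
        using f(1) w e(1) by (simp_all add: m_assoc)
      then have "e \<otimes> w \<otimes> f \<in> jacobson_radical R" "f \<otimes> w \<otimes> e \<in> jacobson_radical R"
        using f w e(1) by (auto intro!: UU_square_zero_in_jacobson_radical[OF P UU])
      then have "e \<otimes> w \<otimes> f \<ominus> f \<otimes> w \<otimes> e \<in> jacobson_radical R"
        by (rule left_ideal_minus[OF J])
      \<comment> \<open>With \<open>f = 1 - e\<close> expanded, the two terms \<open>e w e\<close>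
        cancel.\<close>
      moreover have "e \<otimes> w \<otimes> f \<ominus> f \<otimes> w \<otimes> e = e \<otimes> w \<ominus> w \<otimes> e"
        using w e(1) by (simp add: f_def minus_eq l_distr r_distr l_minus r_minus m_assoc minus_add a_ac r_neg2 r_neg1 r_neg)
      ultimately show ?thesis by simp
    qed
    \<comment> \<open>Exponents start at 1, where the claim is just \<open>e = w a\<close>; at
      exponent 0 it would place \<open>e - 1\<close> in the radical.\<close>
    have "e \<ominus> w [^] Suc k \<otimes> a [^] Suc k \<in> jacobson_radical R" for k :: nat
    proof (induction k)
      case 0
      then show ?case using w a left_ideal_zero[OF J] by (simp add: e_def minus_eq r_neg)
    next
      case (Suc k)
      define p q where "p = w [^] Suc k" and "q = a [^] Suc k"
      have pq: "p \<in> carrier R" "q \<in> carrier R" "w [^] Suc (Suc k) = w \<otimes> p" "a [^] Suc (Suc k) = q \<otimes> a"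
        unfolding p_def q_def using w a nat_pow_Suc2[of w "Suc k"] by auto
      \<comment> \<open>Starting from \<open>e = e w a\<close>, the first summand replaces
        \<open>e w\<close> by \<open>w e\<close> and the second replaces the inner \<open>e\<close>
        by \<open>p q\<close>; the terms \<open>w e a\<close> cancel. Multiplying by
        \<open>a\<close> on the right uses that the radical is two-sided.\<close>
      have "(e \<otimes> w \<ominus> w \<otimes> e) \<otimes> a \<oplus> w \<otimes> (e \<ominus> p \<otimes> q) \<otimes> a \<in> jacobson_radical R"
        using Suc.IH central a w unfolding p_def[symmetric] q_def[symmetric]
        by (intro left_ideal_add[OF J] jacobson_radical_mult_right[OF P] left_ideal_mult[OF J])
      also have "(e \<otimes> w \<ominus> w \<otimes> e) \<otimes> a \<oplus> w \<otimes> (e \<ominus> p \<otimes> q) \<otimes> a = e \<otimes> (w \<otimes> a) \<ominus> (w \<otimes> p) \<otimes> (q \<otimes> a)"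
        using w e(1) a(1) pq(1,2)
        by (simp add: minus_eq l_distr r_distr l_minus r_minus m_assoc a_assoc r_neg1)
      also have "e \<otimes> (w \<otimes> a) = e" using e by (simp add: e_def[symmetric])
      finally show ?case unfolding pq .
    qed
    from this[of n] have "e \<in> jacobson_radical R" using a w e(1) by (simp add: minus_eq)
    then show False using idempotent_in_jacobson_radical e by blast
  qed
qed

text \<open>UJ# and UU agree because \<open>J# = Nil\<close>. Under UJ, \<open>1 + Nil\<close> lies
  in \<open>U = 1 + J\<close>, which lies in \<open>1 + Nil\<close> since \<open>J\<close> is nil;
  under UU, \<open>J\<close> and \<open>Nil\<close> are the same set.\<close>

lemma nil_semipotent_equivalences:
  assumes P: "nil_semipotent R"
  shows "(UJ_sharp_ring R \<longleftrightarrow> UJ_ring R) \<and> (UJ_ring R \<longleftrightarrow> UU_ring R)"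
proof -
  have "UJ_sharp_ring R \<longleftrightarrow> UU_ring R"
    by (simp add: UJ_sharp_ring_def UU_ring_def jacobson_sharp_eq_nilpotents[OF P])
  moreover have "UU_ring R" if "UJ_ring R"
  proof -
    have "\<one> <+\<^bsub>R\<^esub> nilpotents R \<subseteq> Units R"
      using one_plus_nilpotent_Units by (auto simp: a_l_coset_def')
    then show ?thesis
      using that jacobson_radical_nil[OF P] unfolding UJ_ring_def UU_ring_def a_l_coset_def' by blast
  qed
  moreover have "UJ_ring R" if "UU_ring R"
    using that UU_nilpotents_in_jacobson_radical[OF P that] jacobson_radical_nil[OF P]
    unfolding UJ_ring_def UU_ring_def by (metis subset_antisym)
  ultimately show ?thesis by blast
qed

end

theorem corollary3p3:
  fixes R :: "('a, 'b) ring_scheme"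
  assumes "ring R"
    and "left_artinian R \<or> right_artinian R \<or> finite (carrier R)"
  shows "(UJ_sharp_ring R \<longleftrightarrow> UJ_ring R) \<and> (UJ_ring R \<longleftrightarrow> UU_ring R)"
proof -
  interpret ring R by fact
  show ?thesis
    using assms(2) left_artinian_nil_semipotent right_artinian_nil_semipotent
      finite_left_artinian nil_semipotent_equivalences by blast
qed

end
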